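(* There are infinitely many pairwise non-isomorphic Puiseux monoids whose sets of atoms are dense in $\mathbb{R}_{\ge 0}$. That is, there exists an infinite family of pairwise non-isomorphic (as monoids) additive submonoids $M$ of $\mathbb{Q}_{\ge 0}$ such that the set $\mathcal{A}(M)$ of atoms of $M$ is dense in $\mathbb{R}_{\ge 0}$ with respect to the Euclidean topology.
   Context: A Puiseux monoid is an additive submonoid of $\mathbb{Q}_{\ge 0}$. Such a monoid $M$ is reduced (its only invertible element is $0$). An atom of $M$ is an element $a \in M \setminus \{0\}$ such that whenever $a = b + c$ with $b,c \in M$, either $b = 0$ or $c = 0$. The set of atoms of $M$ is denoted by $\mathcal{A}(M)$. *)

theory Defs
  imports "HOL-Analysis.Analysis" "HOL-Algebra.Group"
begin

definition nonneg_rat_monoid :: "rat monoid" where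
  "nonneg_rat_monoid = \<lparr>carrier = {q. 0 \<le> q}, mult = (+), one = 0\<rparr>"

definition puiseux_monoid :: "rat set \<Rightarrow> bool" where
  "puiseux_monoid M \<longleftrightarrow> submonoid M nonneg_rat_monoid"

definition atoms :: "rat set \<Rightarrow> rat set" where
  "atoms M = {a \<in> M - {0}. \<forall>b\<in>M. \<forall>c\<in>M. a = b + c \<longrightarrow> b = 0 \<or> c = 0}"

text \<open>The library relation \<open>\<cong>\<close> asks for a bijection preserving the operation;
  between monoids such a map automatically preserves the neutral element.\<close>

definition puiseux_isomorphic :: "rat set \<Rightarrow> rat set \<Rightarrow> bool" where
  "puiseux_isomorphic M N \<longleftrightarrow>
     nonneg_rat_monoid\<lparr>carrier := M\<rparr> \<cong> nonneg_rat_monoid\<lparr>carrier := N\<rparr>"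

end

theory Submission
  imports Defs "HOL-Computational_Algebra.Primes"
begin

text \<open>For an exponent \<open>k \<ge> 1\<close> let \<open>M\<close> be generated by one fraction \<open>m\<^sub>p / p ^ k\<close> with
  \<open>p \<nmid> m\<^sub>p\<close> for every prime \<open>p\<close>. Since \<open>m\<^sub>p / p ^ k\<close> is the only generator that is not
  integral at \<open>p\<close>, it is an atom, and the numerators are free enough to make the generators dense.
  An isomorphism of Puiseux monoids is multiplication by a positive rational, which does not change
  the valuation at all but finitely many primes; hence \<open>k\<close> is an isomorphism invariant.\<close>

section \<open>Submonoids generated by a set\<close>

inductive_set add_span :: "'a::comm_monoid_add set \<Rightarrow> 'a set" for A where
  zero: "0 \<in> add_span A"
| step: "a \<in> A \<Longrightarrow> x \<in> add_span A \<Longrightarrow> a + x \<in> add_span A"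

lemma add_span_base: "a \<in> A \<Longrightarrow> a \<in> add_span A"
  using add_span.step[OF _ add_span.zero] by fastforce

lemma add_span_add: "x \<in> add_span A \<Longrightarrow> y \<in> add_span A \<Longrightarrow> x + y \<in> add_span A"
  by (induction rule: add_span.induct) (auto simp: add.assoc intro: add_span.step)

lemma add_span_nonneg:
  fixes A :: "'a::ordered_comm_monoid_add set"
  assumes "\<And>a. a \<in> A \<Longrightarrow> 0 \<le> a" "x \<in> add_span A"
  shows "0 \<le> x"
  using assms(2) by induction (auto simp: assms(1))

section \<open>Puiseux monoids and their isomorphisms\<close>

lemma puiseux_monoid_iff:
  "puiseux_monoid M \<longleftrightarrow> (\<forall>x\<in>M. 0 \<le> x) \<and> 0 \<in> M \<and> (\<forall>x\<in>M. \<forall>y\<in>M. x + y \<in> M)"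
  by (auto simp: puiseux_monoid_def nonneg_rat_monoid_def submonoid_def)

lemma puiseux_monoid_add_span:
  assumes "\<And>a. a \<in> A \<Longrightarrow> 0 \<le> a"
  shows "puiseux_monoid (add_span A)"
  using add_span_nonneg[OF assms] by (auto simp: puiseux_monoid_iff add_span.zero add_span_add)

lemma puiseux_isomorphic_iff:
  "puiseux_isomorphic M N \<longleftrightarrow>
    (\<exists>\<phi>. bij_betw \<phi> M N \<and> (\<forall>x\<in>M. \<forall>y\<in>M. \<phi> (x + y) = \<phi> x + \<phi> y))"
  by (auto simp: puiseux_isomorphic_def is_iso_def iso_def hom_def nonneg_rat_monoid_def
      bij_betw_def)

text \<open>Additivity passes to the inverse because \<open>\<phi>\<close> is injective on
  \<open>M\<close>, which is closed under addition. Symmetry serves to turn a one-sided comparison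
  of exponents into an equality.\<close>

lemma puiseux_isomorphic_sym:
  assumes M: "puiseux_monoid M" and iso: "puiseux_isomorphic M N"
  shows "puiseux_isomorphic N M"
proof -
  obtain \<phi> where bij: "bij_betw \<phi> M N"
    and add: "\<And>x y. x \<in> M \<Longrightarrow> y \<in> M \<Longrightarrow> \<phi> (x + y) = \<phi> x + \<phi> y"
    using iso by (auto simp: puiseux_isomorphic_iff)
  define \<psi> where "\<psi> = inv_into M \<phi>"
  have bij': "bij_betw \<psi> N M" using bij by (simp add: \<psi>_def bij_betw_inv_into)
  have "\<psi> (u + v) = \<psi> u + \<psi> v" if "u \<in> N" "v \<in> N" for u v
  proof -
    have mem: "\<psi> u \<in> M" "\<psi> v \<in> M" using that bij' by (auto simp: bij_betw_def)
    have "\<phi> (\<psi> u + \<psi> v) = u + v"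
      using that bij add[OF mem] by (simp add: \<psi>_def bij_betw_inv_into_right)
    moreover have "\<psi> u + \<psi> v \<in> M" using M mem by (simp add: puiseux_monoid_iff)
    ultimately show ?thesis using bij unfolding \<psi>_def by (metis bij_betw_inv_into_left)
  qed
  then show ?thesis using bij' by (auto simp: puiseux_isomorphic_iff)
qed

lemma additive_of_nat_mult:
  fixes \<phi> :: "rat \<Rightarrow> rat"
  assumes M: "puiseux_monoid M"
    and add: "\<And>x y. x \<in> M \<Longrightarrow> y \<in> M \<Longrightarrow> \<phi> (x + y) = \<phi> x + \<phi> y"
    and x: "x \<in> M"
  shows "of_nat n * x \<in> M \<and> \<phi> (of_nat n * x) = of_nat n * \<phi> x"
proof (induction n)
  case 0
  have "0 \<in> M" using M by (simp add: puiseux_monoid_iff)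
  then show ?case using add[of 0 0] by simp
next
  case (Suc n)
  then show ?case using M x add[of x "of_nat n * x"]
    by (simp add: puiseux_monoid_iff distrib_right)
qed

lemma nonneg_rat_fraction:
  assumes "0 \<le> (x::rat)"
  obtains a b :: nat where "0 < b" "x = of_nat a / of_nat b"
proof -
  obtain u v where uv: "quotient_of x = (u, v)" by (cases "quotient_of x")
  then have v: "0 < v" and xuv: "x = of_int u / of_int v"
    using quotient_of_denom_pos quotient_of_div by auto
  then have "0 \<le> u" using assms by (simp add: zero_le_divide_iff)
  with v xuv show ?thesis by (intro that[of "nat v" "nat u"]) auto
qed

text \<open>Any two elements of \<open>M\<close> have a common multiple, so \<open>\<phi>\<close> scales both by the same factor.\<close>

lemma additive_proportional:
  fixes \<phi> :: "rat \<Rightarrow> rat"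
  assumes M: "puiseux_monoid M"
    and add: "\<And>x y. x \<in> M \<Longrightarrow> y \<in> M \<Longrightarrow> \<phi> (x + y) = \<phi> x + \<phi> y"
    and x: "x \<in> M" and y: "y \<in> M"
  shows "x * \<phi> y = y * \<phi> x"
proof -
  obtain a b where ab: "0 < b" "x = of_nat a / of_nat b"
    using nonneg_rat_fraction M x by (metis puiseux_monoid_iff)
  obtain c d where cd: "0 < d" "y = of_nat c / of_nat d"
    using nonneg_rat_fraction M y by (metis puiseux_monoid_iff)
  \<comment> \<open>The common multiple is \<open>a * c\<close>, the product of the
    numerators.\<close>
  have "of_nat (c * b) * x = of_nat (a * d) * y"
  proof -
    have "of_nat b * x = of_nat a" "of_nat d * y = of_nat c" using ab cd by auto
    then show ?thesis by (simp only: of_nat_mult ac_simps) (metis mult.assoc mult.commute)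
  qed
  then have "of_nat (c * b) * \<phi> x = of_nat (a * d) * \<phi> y"
    using additive_of_nat_mult[OF M add x] additive_of_nat_mult[OF M add y] by metis
  \<comment> \<open>Clearing \<open>b\<close> and \<open>d\<close> makes the two equations
    equivalent, so \<open>x = 0\<close> and \<open>y = 0\<close> are covered as well.\<close>
  moreover have "x * v = y * u" if "of_nat (c * b) * u = of_nat (a * d) * v" for u v
    unfolding ab(2) cd(2) using that ab(1) cd(1) by (simp add: field_simps)
  ultimately show ?thesis by blast
qed

text \<open>The ratio \<open>\<phi> x / x\<close> is the same for all nonzero \<open>x\<close>, so
  the single element \<open>x0\<close> determines the factor \<open>r\<close>.\<close>

lemma puiseux_isomorphic_scale:
  assumes M: "puiseux_monoid M" and N: "puiseux_monoid N"
    and iso: "puiseux_isomorphic M N" and x0: "x0 \<in> M" "x0 \<noteq> 0"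
  obtains r where "0 < r" "\<And>x. x \<in> M \<Longrightarrow> r * x \<in> N"
proof -
  obtain \<phi> where bij: "bij_betw \<phi> M N"
    and add: "\<And>x y. x \<in> M \<Longrightarrow> y \<in> M \<Longrightarrow> \<phi> (x + y) = \<phi> x + \<phi> y"
    using iso by (auto simp: puiseux_isomorphic_iff)
  have z: "0 \<in> M" "0 < x0" "0 \<le> \<phi> x0"
    using M N x0 bij by (auto simp: puiseux_monoid_iff bij_betw_def less_le)
  \<comment> \<open>Injectivity separates \<open>\<phi> x0\<close> from \<open>\<phi> 0 = 0\<close>,
    which makes the factor positive.\<close>
  have "\<phi> 0 = 0" using add[OF z(1) z(1)] by simp
  then have "\<phi> x0 \<noteq> 0" using bij x0 z(1) by (metis bij_betw_def inj_on_eq_iff)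
  then have "0 < \<phi> x0 / x0" using z by simp
  moreover have "\<phi> x0 / x0 * x \<in> N" if "x \<in> M" for x
  proof -
    have "\<phi> x0 / x0 * x = \<phi> x"
      using additive_proportional[OF M add x0(1) that] x0(2) by (simp add: field_simps)
    then show ?thesis using bij that by (auto simp: bij_betw_def)
  qed
  ultimately show ?thesis by (rule that)
qed

section \<open>Integrality at a prime\<close>

text \<open>For prime \<open>p\<close> these are the nonnegative elements of the localization of the
  integers at \<open>p\<close>, with 0 included without a special case.\<close>

definition p_integral :: "nat \<Rightarrow> rat \<Rightarrow> bool" where
  "p_integral p x \<longleftrightarrow> (\<exists>a d::nat. \<not> p dvd d \<and> x * of_nat d = of_nat a)"

lemma p_integral_add:
  assumes "prime p" "p_integral p x" "p_integral p y"
  shows "p_integral p (x + y)"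
proof -
  obtain a b c d where "\<not> p dvd b" "x * of_nat b = of_nat a" "\<not> p dvd d" "y * of_nat d = of_nat c"
    using assms(2,3) by (auto simp: p_integral_def)
  moreover from this have "(x + y) * of_nat (b * d) = of_nat (a * d + c * b)"
    by (simp add: algebra_simps)
  ultimately show ?thesis
    unfolding p_integral_def using assms(1) prime_dvd_mult_iff by blast
qed

lemma p_integral_0: "prime p \<Longrightarrow> p_integral p 0"
  unfolding p_integral_def by (auto intro!: exI[of _ 1])

text \<open>Integrality is closed under addition, so checking generators suffices. The factor
  \<open>c\<close> is there to clear powers of \<open>p\<close> from the denominators.\<close>

lemma p_integral_add_span:
  assumes "prime p" "\<And>a. a \<in> A \<Longrightarrow> p_integral p (c * a)" "x \<in> add_span A"
  shows "p_integral p (c * x)"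
  using assms(3)
  by induction (auto simp: distrib_left assms p_integral_0 p_integral_add)

lemma p_integral_fraction:
  assumes "\<not> p dvd b" "0 < b"
  shows "p_integral p (of_nat a / of_nat b)"
  unfolding p_integral_def using assms by (intro exI[of _ a] exI[of _ b]) auto

lemma not_p_integral_fraction:
  assumes "prime p" "\<not> p dvd a" "p dvd b" "0 < b"
  shows "\<not> p_integral p (of_nat a / of_nat b)"
proof
  assume "p_integral p (of_nat a / of_nat b)"
  then obtain c d where d: "\<not> p dvd d" and "of_nat a / of_nat b * of_nat d = (of_nat c :: rat)"
    by (auto simp: p_integral_def)
  then have "(of_nat (a * d) :: rat) = of_nat (c * b)"
    using assms(4) by (simp add: field_simps)
  then have "p dvd a * d" using assms(3) by (metis of_nat_eq_iff dvd_mult)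
  then show False using assms d prime_dvd_mult_iff by blast
qed

section \<open>Monoids generated by prime fractions\<close>

definition prime_fractions :: "nat \<Rightarrow> (nat \<Rightarrow> nat) \<Rightarrow> rat set" where
  "prime_fractions k m = (\<lambda>p. of_nat (m p) / of_nat (p ^ k)) ` {p. prime p}"

lemma prime_fractions_nonneg: "a \<in> prime_fractions k m \<Longrightarrow> 0 \<le> a"
  by (auto simp: prime_fractions_def)

lemma prime_fractions_nonzero:
  assumes "\<And>p. prime p \<Longrightarrow> \<not> p dvd m p"
  shows "0 \<notin> prime_fractions k m"
  using assms by (auto simp: prime_fractions_def) (metis dvd_0_right)

lemma puiseux_monoid_prime_fractions: "puiseux_monoid (add_span (prime_fractions k m))"
  by (rule puiseux_monoid_add_span) (rule prime_fractions_nonneg)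

text \<open>A sum of generators that uses \<open>a\<close> is at least \<open>a\<close>; one that
  avoids \<open>a\<close> is integral at \<open>p\<close>. As \<open>a\<close> itself is not
  integral at \<open>p\<close>, one summand of \<open>a = b + c\<close> is at least
  \<open>a\<close>, and the other vanishes.\<close>

lemma prime_fractions_subset_atoms:
  assumes m: "\<And>p. prime p \<Longrightarrow> \<not> p dvd m p" and k: "0 < k"
  shows "prime_fractions k m \<subseteq> atoms (add_span (prime_fractions k m))"
proof
  fix a assume a: "a \<in> prime_fractions k m"
  then obtain p where p: "prime p" and ap: "a = of_nat (m p) / of_nat (p ^ k)"
    by (auto simp: prime_fractions_def)
  let ?M = "add_span (prime_fractions k m)"
  have nonneg: "0 \<le> x" if "x \<in> ?M" for x
    using that add_span_nonneg prime_fractions_nonneg by blast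
  have gens: "p_integral p b" if b: "b \<in> prime_fractions k m" "b \<noteq> a" for b
  proof -
    obtain q where q: "prime q" "b = of_nat (m q) / of_nat (q ^ k)"
      using b(1) by (auto simp: prime_fractions_def)
    then have "p \<noteq> q" using b(2) ap by blast
    then have "\<not> p dvd q ^ k" using p q(1) prime_dvd_power primes_dvd_imp_eq by blast
    then show ?thesis unfolding q(2) using q(1) by (intro p_integral_fraction) (auto simp: prime_gt_0_nat)
  qed
  have dich: "p_integral p x \<or> a \<le> x" if "x \<in> ?M" for x
    using that
  proof induction
    case zero
    then show ?case using p by (simp add: p_integral_0)
  next
    case (step b x)
    then show ?case
      using nonneg[OF step(2)] prime_fractions_nonneg[OF step(1)] gens[OF step(1)] p_integral_add[OF p]
      by (cases "b = a") (auto simp: add_increasing add_increasing2)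
  qed
  have "\<not> p_integral p a"
    unfolding ap using p m k by (intro not_p_integral_fraction) (auto simp: prime_gt_0_nat)
  then have "b = 0 \<or> c = 0" if "b \<in> ?M" "c \<in> ?M" "a = b + c" for b c
    using dich[OF that(1)] dich[OF that(2)] nonneg[OF that(1)] nonneg[OF that(2)]
      p_integral_add[OF p] that(3) by auto
  moreover have "a \<noteq> 0" using a prime_fractions_nonzero m by blast
  ultimately show "a \<in> atoms ?M"
    unfolding atoms_def using add_span_base[OF a] by blast
qed

text \<open>For large \<open>p\<close>, scaling by \<open>r\<close> keeps the full
  \<open>p ^ k\<close> in the denominator of the generator at \<open>p\<close>, while
  \<open>p ^ l\<close> clears \<open>p\<close> from all denominators in the target.\<close>

lemma prime_fractions_isomorphic_le:
  assumes m: "\<And>p. prime p \<Longrightarrow> \<not> p dvd m p"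
    and iso: "puiseux_isomorphic (add_span (prime_fractions k m)) (add_span (prime_fractions l n))"
  shows "k \<le> l"
proof (rule ccontr)
  assume "\<not> k \<le> l"
  then have lk: "l < k" by simp
  have mem: "of_nat (m p) / of_nat (p ^ k) \<in> add_span (prime_fractions k m)" if "prime p" for p
    using that by (intro add_span_base) (auto simp: prime_fractions_def)
  \<comment> \<open>The generator at the prime 2 is the nonzero element that fixes the scaling
    factor; \<open>m 2\<close> is odd.\<close>
  have "of_nat (m 2) / of_nat (2 ^ k) \<noteq> (0 :: rat)"
    using m[of 2] by (auto intro: odd_pos)
  then obtain r where r: "0 < r"
    and rN: "\<And>x. x \<in> add_span (prime_fractions k m) \<Longrightarrow> r * x \<in> add_span (prime_fractions l n)"
    using puiseux_isomorphic_scale[OF puiseux_monoid_prime_fractions puiseux_monoid_prime_fractions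
        iso mem[OF two_is_prime_nat]] by auto
  obtain u v where v: "0 < v" and ruv: "r = of_nat u / of_nat v"
    using nonneg_rat_fraction less_imp_le[OF r] by blast
  have u: "0 < u" using r ruv by (cases u) auto
  \<comment> \<open>Being larger than both, \<open>p\<close> divides neither of the positive numbers
    \<open>u\<close> and \<open>v\<close>.\<close>
  obtain p where p: "prime p" and pgt: "u + v < p" using bigger_prime by blast
  have p0: "0 < p" using p by (rule prime_gt_0_nat)
  have gens: "p_integral p (of_nat (p ^ l) * a)" if "a \<in> prime_fractions l n" for a
  proof -
    obtain q where q: "prime q" "a = of_nat (n q) / of_nat (q ^ l)"
      using \<open>a \<in> prime_fractions l n\<close> unfolding prime_fractions_def by blast
    show ?thesis
    proof (cases "q = p")
      case True
      then have "of_nat (p ^ l) * a = of_nat (n p) / of_nat 1" using q p0 by simp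
      then show ?thesis using p by (simp only:) (rule p_integral_fraction, auto)
    next
      case False
      then have "\<not> p dvd q ^ l" using p q(1) prime_dvd_power primes_dvd_imp_eq by blast
      then have "p_integral p (of_nat (p ^ l * n q) / of_nat (q ^ l))"
        using q(1) by (intro p_integral_fraction) (auto simp: prime_gt_0_nat)
      then show ?thesis using q by simp
    qed
  qed
  have "p_integral p (of_nat (p ^ l) * (r * (of_nat (m p) / of_nat (p ^ k))))"
    using p_integral_add_span[OF p gens rN[OF mem[OF p]]] .
  \<comment> \<open>Since \<open>l < k\<close>, a factor \<open>p\<close> survives in the
    denominator.\<close>
  also have "of_nat (p ^ l) * (r * (of_nat (m p) / of_nat (p ^ k)))
      = (of_nat (u * m p) / of_nat (v * p ^ (k - l)) :: rat)"
    using lk p0 v by (simp add: ruv field_simps flip: power_add)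
  finally have "p_integral p (of_nat (u * m p) / of_nat (v * p ^ (k - l)))" .
  moreover have "\<not> p dvd u" using u pgt by (auto dest: dvd_imp_le)
  ultimately show False
    using not_p_integral_fraction[OF p, of "u * m p" "v * p ^ (k - l)"] m[OF p] lk v p0 p
    by (auto simp: prime_dvd_mult_iff)
qed

section \<open>Density of the generators\<close>

text \<open>Every rational number is \<open>q p\<close> for some prime \<open>p\<close>; a generator then only has to lie within
  \<open>1 / p\<close> of \<open>q p\<close>, because each interval contains \<open>q p\<close> for arbitrarily large \<open>p\<close>.\<close>

lemma dense_if_near_prime_indexed:
  fixes q a :: "nat \<Rightarrow> rat"
  assumes q: "q ` {p. prime p} = UNIV"
    and near: "\<And>p. prime p \<Longrightarrow> 0 \<le> q p \<Longrightarrow> \<bar>a p - q p\<bar> \<le> 1 / of_nat p"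
  shows "{0..} \<subseteq> closure (real_of_rat ` a ` {p. prime p})"
proof
  fix x :: real assume "x \<in> {0..}"
  then have x: "0 \<le> x" by simp
  show "x \<in> closure (real_of_rat ` a ` {p. prime p})"
    unfolding closure_approachable
  proof (intro allI impI)
    fix e :: real assume e: "0 < e"
    \<comment> \<open>The interval lies to the right of \<open>x\<close>, so that \<open>q p\<close>
      is positive and \<open>near\<close> applies; the other half of \<open>e\<close> is left for
      the distance from \<open>a p\<close> to \<open>q p\<close>.\<close>
    let ?S = "{p. prime p \<and> real_of_rat (q p) \<in> {x<..<x + e / 2}}"
    have "infinite ?S"
    proof
      assume fin: "finite ?S"
      \<comment> \<open>A rational strictly between \<open>x\<close> and the least hit would be a
        further hit. The endpoint \<open>x + e / 2\<close> makes \<open>B\<close> nonempty and keeps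
        that rational inside the interval.\<close>
      define B where "B = insert (x + e / 2) ((real_of_rat \<circ> q) ` ?S)"
      have "finite B" "B \<noteq> {}" using fin by (auto simp: B_def)
      moreover have "\<forall>b\<in>B. x < b" using e by (auto simp: B_def)
      ultimately have "x < Min B" by simp
      then obtain s where s: "x < of_rat s" "of_rat s < Min B" using of_rat_dense by blast
      have le: "b \<in> B \<Longrightarrow> of_rat s < b" for b
        using s(2) \<open>finite B\<close> by (meson Min_le less_le_trans)
      obtain p where p: "prime p" "q p = s" using q by (metis (no_types, lifting) UNIV_I imageE mem_Collect_eq)
      have "of_rat s < x + e / 2" using le by (auto simp: B_def)
      then have "p \<in> ?S" using p s(1) by simp
      then have "of_rat s \<in> B" using p by (auto simp: B_def)
      then show False using le by blast
    qed
    moreover obtain n :: nat where n: "2 / e < real n" using reals_Archimedean2 by blast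
    ultimately obtain p where p: "n < p" "p \<in> ?S" by (meson infinite_nat_iff_unbounded)
    have "0 < real_of_rat (q p)" using p(2) x by (simp del: zero_less_of_rat_iff)
    then have "\<bar>a p - q p\<bar> \<le> 1 / of_nat p" using near p by simp
    then have "real_of_rat \<bar>a p - q p\<bar> \<le> of_rat (1 / of_nat p)" by (simp only: of_rat_less_eq)
    then have "\<bar>real_of_rat (a p) - of_rat (q p)\<bar> \<le> 1 / real p"
      by (simp add: of_rat_divide flip: of_rat_diff)
    also have "\<dots> < e / 2"
    proof -
      have "2 / e < real p" "0 < p" using n p(1) by linarith+
      then show ?thesis using e by (simp add: field_simps)
    qed
    finally have "dist (real_of_rat (a p)) x < e"
      using p(2) unfolding dist_real_def mem_Collect_eq greaterThanLessThan_iff by linarith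
    then show "\<exists>y\<in>real_of_rat ` a ` {p. prime p}. dist y x < e" using p by blast
  qed
qed

lemma closure_atoms_subset:
  assumes "puiseux_monoid M"
  shows "closure (real_of_rat ` atoms M) \<subseteq> {0..}"
  using assms by (intro closure_minimal) (auto simp: atoms_def puiseux_monoid_iff)

text \<open>The primes are in bijection with the naturals, which \<open>from_nat\<close> maps onto
  the countable type \<open>rat\<close>.\<close>

lemma prime_sequence_onto_rats: "\<exists>q :: nat \<Rightarrow> rat. q ` {p. prime p} = UNIV"
proof -
  obtain f where f: "bij_betw f {p::nat. prime p} (UNIV :: nat set)"
    using countableE_infinite[of "{p::nat. prime p}"] primes_infinite by blast
  have "(from_nat \<circ> f) ` {p. prime p} = (UNIV :: rat set)"
    using f by (simp add: bij_betw_def flip: image_image image_comp)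
  then show ?thesis by blast
qed

section \<open>Choice of numerators and the infinite family\<close>

text \<open>Being 1 modulo \<open>p\<close>, the numerator is prime to \<open>p\<close>. It belongs
  over \<open>p ^ Suc k\<close>: the factor \<open>p\<close> offsets the extra power, leaving
  \<open>q p\<close> rounded down to a multiple of \<open>1 / p ^ k\<close>, up to a small error.
  Negative \<open>q p\<close> are truncated to the numerator 1.\<close>

definition numer :: "(nat \<Rightarrow> rat) \<Rightarrow> nat \<Rightarrow> nat \<Rightarrow> nat" where
  "numer q k p = p * nat \<lfloor>q p * of_nat (p ^ k)\<rfloor> + 1"

lemma not_dvd_numer: "prime p \<Longrightarrow> \<not> p dvd numer q k p"
  unfolding numer_def by (metis dvd_add_right_iff dvd_triv_left not_prime_unit)

lemma numer_near:
  assumes p: "prime p" and k: "0 < k" and q: "0 \<le> q p"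
  shows "\<bar>of_nat (numer q k p) / of_nat (p ^ Suc k) - q p\<bar> \<le> 1 / of_nat p"
proof -
  define P :: rat where "P = of_nat p"
  define f where "f = \<lfloor>q p * P ^ k\<rfloor>"
  have P: "1 < P" using prime_gt_1_nat[OF p] by (simp add: P_def)
  have f: "0 \<le> f" "of_int f \<le> q p * P ^ k" "q p * P ^ k < of_int f + 1"
    unfolding f_def using q P by (simp, linarith+)
  have n: "of_nat (numer q k p) = P * of_int f + 1"
    using f(1) by (simp add: numer_def f_def P_def)
  \<comment> \<open>The rounding error lies in \<open>(-1, 0]\<close> and \<open>1 / P\<close> in
    \<open>(0, 1]\<close>, so the bracket has absolute value at most 1.\<close>
  have *: "of_nat (numer q k p) / of_nat (p ^ Suc k) - q p
      = (of_int f - q p * P ^ k + 1 / P) / P ^ k"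
    unfolding n using P by (simp add: P_def field_simps)
  have "1 / P \<le> 1" "0 < 1 / P" using P by auto
  then have "\<bar>of_int f - q p * P ^ k + 1 / P\<bar> \<le> 1"
    using f by linarith
  then have "\<bar>(of_int f - q p * P ^ k + 1 / P) / P ^ k\<bar> \<le> 1 / P ^ k"
    using P by (simp add: abs_divide divide_right_mono)
  also have "\<dots> \<le> 1 / P"
    using P k power_increasing[of 1 k P] by (auto simp: field_simps)
  finally show ?thesis unfolding * by (simp add: P_def)
qed

theorem theorem3p5:
  shows "\<exists>\<F> :: rat set set. infinite \<F> \<and>
           (\<forall>M\<in>\<F>. puiseux_monoid M \<and> closure (real_of_rat ` atoms M) = {0..}) \<and>
           pairwise (\<lambda>M N. \<not> puiseux_isomorphic M N) \<F>"
proof -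
  obtain q :: "nat \<Rightarrow> rat" where q: "q ` {p. prime p} = UNIV"
    using prime_sequence_onto_rats by blast
  define M where "M k = add_span (prime_fractions (Suc k) (numer q k))" for k
  have pm: "puiseux_monoid (M k)" for k
    by (simp add: M_def puiseux_monoid_prime_fractions)
  have iso_le: "k \<le> l" if "puiseux_isomorphic (M k) (M l)" for k l
    using prime_fractions_isomorphic_le[OF not_dvd_numer that[unfolded M_def]] by simp
  have iso_eq: "k = l" if "puiseux_isomorphic (M k) (M l)" for k l
    using that iso_le puiseux_isomorphic_sym[OF pm that] by (simp add: order_antisym)
  have "puiseux_isomorphic (M k) (M k)" for k
    by (simp add: puiseux_isomorphic_def iso_refl)
  \<comment> \<open>Equal monoids are isomorphic, so distinct indices give distinct monoids. Index 0
    is left out because the error bound \<open>1 / p ^ k\<close> must be at most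
    \<open>1 / p\<close>.\<close>
  then have "inj_on M {0<..}" using iso_eq by (metis inj_onI)
  then have "infinite (M ` {0<..})" using infinite_Ioi finite_imageD by blast
  moreover have "closure (real_of_rat ` atoms (M k)) = {0..}" if "0 < k" for k
  proof
    show "closure (real_of_rat ` atoms (M k)) \<subseteq> {0..}" by (rule closure_atoms_subset[OF pm])
    have "{0..} \<subseteq> closure (real_of_rat ` prime_fractions (Suc k) (numer q k))"
      unfolding prime_fractions_def
      by (rule dense_if_near_prime_indexed[OF q]) (rule numer_near[OF _ that])
    also have "\<dots> \<subseteq> closure (real_of_rat ` atoms (M k))"
      unfolding M_def
      by (intro closure_mono image_mono prime_fractions_subset_atoms not_dvd_numer) auto
    finally show "{0..} \<subseteq> closure (real_of_rat ` atoms (M k))" .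
  qed
  moreover have "pairwise (\<lambda>M N. \<not> puiseux_isomorphic M N) (M ` {0<..})"
    using iso_eq by (auto simp: pairwise_def)
  ultimately show ?thesis using pm by (intro exI[of _ "M ` {0<..}"]) auto
qed

end
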